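(* Let $n\ge 2$ and let $C_1,\dots,C_n\in\mathcal C$ be a sample of curves. For every $C\in\mathcal C$, the four sample depths $D_{\mathrm{int}}(C\mid\{C_i\})$, $D_{\mathrm{inf}}(C\mid\{C_i\})$, $D_{\mathrm{FW}}(C\mid\{C_i\})$ and $D_{\mathrm{FW}}^{\inf}(C\mid\{C_i\})$ all lie in $[0,1]$.
   Context: Curve space. Let $\mathbb S^1=[0,1]/\{0\sim1\}$ and $I\in\{[0,1],\mathbb S^1\}$. $\mathcal F(I)$ is the set of continuous maps $f:I\to\mathbb R^2$ of finite length $L(f)=\sup\sum_j\|f(\tau_j)-f(\tau_{j-1})\|_2$ (supremum over partitions $0=\tau_0<\dots<\tau_J=1$) whose arc-length map $s_f(t)=L(f|_{[0,t]})$ is strictly increasing (for $I=\mathbb S^1$, $f$ is identified with a continuous map on $[0,1]$ with $f(0)=f(1)$). Write $f_1\sim f_2$ if $f_1=f_2\circ\phi$ for an orientation-preserving or orientation-reversing homeomorphism $\phi:I\to I$. The curve space is $\mathcal C=(\mathcal F([0,1])/\!\sim)\sqcup(\mathcal F(\mathbb S^1)/\!\sim)$; elements of the first part are called open, of the second part closed. For $C\in\mathcal C$, the length $L(C)=L(f)$ and the trace $\Gamma_C=f(I)$ do not depend on the representative $f\in C$. Standing assumption: $L(C)>0$ for all curves considered. In set-theoretic expressions $C$ is identified with $\Gamma_C$. Arc-length representative and measure. An arc-length representative of $C$ is $\beta_C^{\mathrm{arc}}=f\circ s_f^{-1}$ on $[0,L(C)]$ (with $0\sim L(C)$ identified if $C$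 is closed), for a representative $f$ of $C$; it is unique up to orientation reversal (open case), or up to circular shift and reversal (closed case). The arc-length probability measure is $\mu_C(B)=\frac1{L(C)}\int_0^{L(C)}\mathbf 1_B(\beta_C^{\mathrm{arc}}(s))\,ds$ for Borel $B\subseteq\mathbb R^2$; it depends only on $C$ and is assumed non-atomic. Global band: $\mathcal R(A,B)=\{(1-\lambda)x+\lambda y: x\in\Gamma_A,\ y\in\Gamma_B,\ \lambda\in[0,1]\}$. Fast-walk (FW) band. Put $\beta_C(t)=\beta_C^{\mathrm{arc}}(L(C)t)$ on $[0,1]$ or $\mathbb S^1$. If $C$ is open, $\mathcal G(C)=\{\beta_C,\beta_C^{\leftarrow}\}$ with $\beta_C^{\leftarrow}(t)=\beta_C(1-t)$. If $C$ is closed, $\mathcal G(C)=\{\beta_C^\theta,(\beta_C^\theta)^{\leftarrow}:\theta\in\mathbb S^1\}$ with $\beta_C^\theta(t)=\beta_C(t+\theta \bmod 1)$ and $(\beta_C^\theta)^{\leftarrow}(t)=\beta_C(\theta-t \bmod 1)$ (so each element has equal values at $0$ and $1$). For $\alpha\in\mathcal G(A)$, $\beta\in\mathcal G(B)$, let $\gamma_{\alpha,\beta}:\mathbb S^1\to\mathbb R^2$ be the closed loop obtained by concatenating $\alpha$ on $[0,1]$, the segment from $\alpha(1)$ to $\beta(1)$, $\beta$ traversed in reverse, and the segment from $\beta(0)$ to $\alpha(0)$ (each on a quarter of $\mathbb S^1$), and let $W(\alpha,\beta)$ be its image. For $p\notin W(\alpha,\beta)$ let $n_2(\gamma_{\alpha,\beta};p)\in\{0,1\}$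 be the degree of $t\mapsto(\gamma_{\alpha,\beta}(t)-p)/\|\gamma_{\alpha,\beta}(t)-p\|$ reduced mod $2$. Set $E(\alpha,\beta)=W(\alpha,\beta)\cup\{p\notin W(\alpha,\beta): n_2(\gamma_{\alpha,\beta};p)=1\}$ and $\Delta(\alpha,\beta)=\|\alpha(1)-\beta(1)\|_2+\|\alpha(0)-\beta(0)\|_2$; let $\mathcal M(A,B)$ be the set of minimizers of $\Delta$ over $\mathcal G(A)\times\mathcal G(B)$. The FW band is $R_{\mathrm{FW}}(A,B)=\mathrm{cl}\bigl(\bigcup_{(\alpha,\beta)\in\mathcal M(A,B)}E(\alpha,\beta)\bigr)$. Depths. For a band $\mathcal R_b\in\{\mathcal R,R_{\mathrm{FW}}\}$: the integral depth is $\binom n2^{-1}\sum_{1\le i<j\le n}\mu_C(\mathcal R_b(C_i,C_j))$ and the infimal depth is $\binom n2^{-1}\sum_{1\le i<j\le n}\mathbf 1\{\mu_C(\mathcal R_b(C_i,C_j))=1\}$. For $\mathcal R_b=\mathcal R$ they are denoted $D_{\mathrm{int}}(C\mid\{C_i\})$ and $D_{\mathrm{inf}}(C\mid\{C_i\})$; for $\mathcal R_b=R_{\mathrm{FW}}$ they are denoted $D_{\mathrm{FW}}(C\mid\{C_i\})$ and $D_{\mathrm{FW}}^{\inf}(C\mid\{C_i\})$. *)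

theory Defs
  imports "HOL-Analysis.Analysis" "HOL-Homology.Homology"
begin

section \<open>Parametrised curves and the curve space\<close>

type_synonym param = "real \<Rightarrow> real ^ 2"

definition polygonal_lengths :: "param \<Rightarrow> real \<Rightarrow> real \<Rightarrow> real set" where
  "polygonal_lengths f a b =
     {(\<Sum>j = 1..J. norm (f (\<tau> j) - f (\<tau> (j - 1)))) | (\<tau> :: nat \<Rightarrow> real) J.
        \<tau> 0 = a \<and> \<tau> J = b \<and> (\<forall>j<J. \<tau> j < \<tau> (Suc j))}"

definition finite_length :: "param \<Rightarrow> bool" where
  "finite_length f \<longleftrightarrow> bdd_above (polygonal_lengths f 0 1)"

definition length_on :: "param \<Rightarrow> real \<Rightarrow> real \<Rightarrow> real" where
  "length_on f a b = Sup (polygonal_lengths f a b)"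

definition arc_length_map :: "param \<Rightarrow> real \<Rightarrow> real" where
  "arc_length_map f t = length_on f 0 t"

text \<open>Parametrisations are total functions on the reals of which only the values on
  \<open>{0..1}\<close> matter; the reparametrisation relations below ignore all other values.\<close>

definition open_params :: "param set" where
  "open_params = {f. continuous_on {0..1} f \<and> finite_length f \<and>
                     strict_mono_on {0..1} (arc_length_map f)}"

definition closed_params :: "param set" where
  "closed_params = {f. continuous_on {0..1} f \<and> f 0 = f 1 \<and> finite_length f \<and>
                       strict_mono_on {0..1} (arc_length_map f)}"

text \<open>The circle \<open>[0,1]/{0 ~ 1}\<close> is modelled by the complex unit circle through
  \<open>t \<mapsto> exp (2 * pi * \<i> * t)\<close>, whose inverse with values in \<open>{0..<1}\<close> is
  \<open>z \<mapsto> Arg2pi z / (2 * pi)\<close>.  For \<open>f 0 = f 1\<close>, \<open>on_circle f\<close> is the map that \<open>f\<close> induces on the circle.\<close>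

definition on_circle :: "(real \<Rightarrow> 'a) \<Rightarrow> complex \<Rightarrow> 'a" where
  "on_circle f z = f (Arg2pi z / (2 * pi))"

text \<open>A homeomorphism of the interval or of the circle either preserves or reverses orientation,
  so arbitrary homeomorphisms are allowed.\<close>

definition open_reparam :: "(param \<times> param) set" where
  "open_reparam = {(f, g). f \<in> open_params \<and> g \<in> open_params \<and>
     (\<exists>\<phi> \<psi>. homeomorphism {0..1} {0..1} \<phi> \<psi> \<and> (\<forall>t\<in>{0..1}. f t = g (\<phi> t)))}"

definition closed_reparam :: "(param \<times> param) set" where
  "closed_reparam = {(f, g). f \<in> closed_params \<and> g \<in> closed_params \<and>
     (\<exists>\<phi> \<psi>. homeomorphism (sphere 0 1) (sphere 0 1) \<phi> \<psi> \<and>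
        (\<forall>z\<in>sphere 0 1. on_circle f z = on_circle g (\<phi> z)))}"

lemma equiv_open_reparam: "equiv open_params open_reparam"
proof (rule equivI)
  show "open_reparam \<subseteq> open_params \<times> open_params"
    by (auto simp: open_reparam_def)
  show "refl_on open_params open_reparam"
    by (auto simp: refl_on_def open_reparam_def intro!: exI[of _ id] homeomorphism_ident[folded id_def])
  show "sym open_reparam"
  proof (rule symI)
    fix f g assume "(f, g) \<in> open_reparam"
    then obtain \<phi> \<psi> where P: "f \<in> open_params" "g \<in> open_params"
      and h: "homeomorphism {0..1} {0..1} \<phi> \<psi>" and e: "\<forall>t\<in>{0..1}. f t = g (\<phi> t)"
      unfolding open_reparam_def by blast
    have "\<forall>t\<in>{0..1}. g t = f (\<psi> t)"
      using h e unfolding homeomorphism_def by (metis image_eqI)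
    with P homeomorphism_symD[OF h] show "(g, f) \<in> open_reparam"
      unfolding open_reparam_def by blast
  qed
  show "trans open_reparam"
  proof (rule transI)
    fix f g k assume "(f, g) \<in> open_reparam" "(g, k) \<in> open_reparam"
    then obtain \<phi> \<psi> \<phi>' \<psi>' where P: "f \<in> open_params" "k \<in> open_params"
      and h: "homeomorphism {0..1} {0..1} \<phi> \<psi>" and e: "\<forall>t\<in>{0..1}. f t = g (\<phi> t)"
      and h': "homeomorphism {0..1} {0..1} \<phi>' \<psi>'" and e': "\<forall>t\<in>{0..1}. g t = k (\<phi>' t)"
      unfolding open_reparam_def by blast
    have "\<forall>t\<in>{0..1}. f t = k ((\<phi>' \<circ> \<phi>) t)"
      using h e e' unfolding homeomorphism_def by (metis comp_apply image_eqI)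
    with P homeomorphism_compose[OF h h'] show "(f, k) \<in> open_reparam"
      unfolding open_reparam_def by blast
  qed
qed

lemma equiv_closed_reparam: "equiv closed_params closed_reparam"
proof (rule equivI)
  show "closed_reparam \<subseteq> closed_params \<times> closed_params"
    by (auto simp: closed_reparam_def)
  show "refl_on closed_params closed_reparam"
    by (auto simp: refl_on_def closed_reparam_def intro!: exI[of _ id] homeomorphism_ident[folded id_def])
  show "sym closed_reparam"
  proof (rule symI)
    fix f g assume "(f, g) \<in> closed_reparam"
    then obtain \<phi> \<psi> where P: "f \<in> closed_params" "g \<in> closed_params"
      and h: "homeomorphism (sphere 0 1) (sphere 0 1) \<phi> \<psi>"
      and e: "\<forall>z\<in>sphere 0 1. on_circle f z = on_circle g (\<phi> z)"
      unfolding closed_reparam_def by blast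
    have "\<forall>z\<in>sphere 0 1. on_circle g z = on_circle f (\<psi> z)"
      using h e unfolding homeomorphism_def by (metis image_eqI)
    with P homeomorphism_symD[OF h] show "(g, f) \<in> closed_reparam"
      unfolding closed_reparam_def by blast
  qed
  show "trans closed_reparam"
  proof (rule transI)
    fix f g k assume "(f, g) \<in> closed_reparam" "(g, k) \<in> closed_reparam"
    then obtain \<phi> \<psi> \<phi>' \<psi>' where P: "f \<in> closed_params" "k \<in> closed_params"
      and h: "homeomorphism (sphere 0 1) (sphere 0 1) \<phi> \<psi>"
      and e: "\<forall>z\<in>sphere 0 1. on_circle f z = on_circle g (\<phi> z)"
      and h': "homeomorphism (sphere 0 1) (sphere 0 1) \<phi>' \<psi>'"
      and e': "\<forall>z\<in>sphere 0 1. on_circle g z = on_circle k (\<phi>' z)"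
      unfolding closed_reparam_def by blast
    have "\<forall>z\<in>sphere 0 1. on_circle f z = on_circle k ((\<phi>' \<circ> \<phi>) z)"
      using h e e' unfolding homeomorphism_def by (metis comp_apply image_eqI)
    with P homeomorphism_compose[OF h h'] show "(f, k) \<in> closed_reparam"
      unfolding closed_reparam_def by blast
  qed
qed

text \<open>\<open>Inl\<close> tags the open curves and \<open>Inr\<close> the closed ones.\<close>

type_synonym curve = "param set + param set"

definition curves :: "curve set" where
  "curves = (open_params // open_reparam) <+> (closed_params // closed_reparam)"

text \<open>Length, trace, arc-length measure and the families \<open>reparams\<close> below are computed from an
  arbitrarily chosen representative; they do not depend on the choice.\<close>

definition rep :: "curve \<Rightarrow> param" where
  "rep C = (case C of Inl X \<Rightarrow> (SOME f. f \<in> X) | Inr X \<Rightarrow> (SOME f. f \<in> X))"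

definition curve_length :: "curve \<Rightarrow> real" where
  "curve_length C = length_on (rep C) 0 1"

definition trace :: "curve \<Rightarrow> (real ^ 2) set" where
  "trace C = path_image (rep C)"


section \<open>Arc-length representative and measure\<close>

definition arc_rep :: "curve \<Rightarrow> param" where
  "arc_rep C s = rep C (the_inv_into {0..1} (arc_length_map (rep C)) s)"

definition arc_measure :: "curve \<Rightarrow> (real ^ 2) measure" where
  "arc_measure C = scale_measure (ennreal (1 / curve_length C))
     (distr (restrict_space lborel {0..curve_length C}) borel (arc_rep C))"

definition non_atomic :: "'a measure \<Rightarrow> bool" where
  "non_atomic M \<longleftrightarrow> \<not> (\<exists>A\<in>sets M. emeasure M A > 0 \<and>
     (\<forall>B\<in>sets M. B \<subseteq> A \<longrightarrow> emeasure M B = 0 \<or> emeasure M B = emeasure M A))"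


section \<open>Bands\<close>

definition global_band :: "curve \<Rightarrow> curve \<Rightarrow> (real ^ 2) set" where
  "global_band A B =
     {(1 - l) *\<^sub>R x + l *\<^sub>R y | l x y. x \<in> trace A \<and> y \<in> trace B \<and> l \<in> {0..1}}"

definition unit_rep :: "curve \<Rightarrow> param" where
  "unit_rep C t = arc_rep C (curve_length C * t)"

definition reparams :: "curve \<Rightarrow> param set" where
  "reparams C = (case C of
      Inl _ \<Rightarrow> {unit_rep C, \<lambda>t. unit_rep C (1 - t)}
    | Inr _ \<Rightarrow> (\<Union>\<theta>\<in>{0..<1}. {\<lambda>t. unit_rep C (frac (t + \<theta>)), \<lambda>t. unit_rep C (frac (\<theta> - t))}))"

definition fw_loop :: "param \<Rightarrow> param \<Rightarrow> param" where
  "fw_loop \<alpha> \<beta> = (\<alpha> +++ linepath (\<alpha> 1) (\<beta> 1)) +++ (reversepath \<beta> +++ linepath (\<beta> 0) (\<alpha> 0))"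

text \<open>The degree of a circle map \<open>u\<close> with \<open>u 0 = u 1\<close> and \<open>norm (u t) = 1\<close>, as the Brouwer degree
  of the induced self-map of \<open>nsphere 1\<close>, whose points are sequences supported on the indices
  \<open>0\<close> and \<open>1\<close>.\<close>

definition circle_degree :: "param \<Rightarrow> int" where
  "circle_degree u = Brouwer_degree2 1
     (\<lambda>x i. let v = on_circle u (Complex (x 0) (x 1))
            in if i = 0 then v $ 1 else if i = 1 then v $ 2 else 0)"

definition n2 :: "param \<Rightarrow> real ^ 2 \<Rightarrow> int" where
  "n2 \<gamma> p = circle_degree (\<lambda>t. (\<gamma> t - p) /\<^sub>R norm (\<gamma> t - p)) mod 2"

definition fw_region :: "param \<Rightarrow> param \<Rightarrow> (real ^ 2) set" where
  "fw_region \<alpha> \<beta> = (let W = path_image (fw_loop \<alpha> \<beta>)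
     in W \<union> {p. p \<notin> W \<and> n2 (fw_loop \<alpha> \<beta>) p = 1})"

definition endpoint_cost :: "param \<times> param \<Rightarrow> real" where
  "endpoint_cost = (\<lambda>(\<alpha>, \<beta>). norm (\<alpha> 1 - \<beta> 1) + norm (\<alpha> 0 - \<beta> 0))"

definition fw_minimizers :: "curve \<Rightarrow> curve \<Rightarrow> (param \<times> param) set" where
  "fw_minimizers A B =
     {q. is_arg_min endpoint_cost (\<lambda>q. q \<in> reparams A \<times> reparams B) q}"

definition fw_band :: "curve \<Rightarrow> curve \<Rightarrow> (real ^ 2) set" where
  "fw_band A B = closure (\<Union>(\<alpha>, \<beta>)\<in>fw_minimizers A B. fw_region \<alpha> \<beta>)"


section \<open>Sample depths\<close>

definition integral_depth ::
  "(curve \<Rightarrow> curve \<Rightarrow> (real ^ 2) set) \<Rightarrow> nat \<Rightarrow> (nat \<Rightarrow> curve) \<Rightarrow> curve \<Rightarrow> real" where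
  "integral_depth band n Cs C = inverse (real (n choose 2)) *
     (\<Sum>(i, j) | 1 \<le> i \<and> i < j \<and> j \<le> n. measure (arc_measure C) (band (Cs i) (Cs j)))"

definition infimal_depth ::
  "(curve \<Rightarrow> curve \<Rightarrow> (real ^ 2) set) \<Rightarrow> nat \<Rightarrow> (nat \<Rightarrow> curve) \<Rightarrow> curve \<Rightarrow> real" where
  "infimal_depth band n Cs C = inverse (real (n choose 2)) *
     (\<Sum>(i, j) | 1 \<le> i \<and> i < j \<and> j \<le> n.
        of_bool (measure (arc_measure C) (band (Cs i) (Cs j)) = 1))"

definition D_int :: "nat \<Rightarrow> (nat \<Rightarrow> curve) \<Rightarrow> curve \<Rightarrow> real" where
  "D_int = integral_depth global_band"

definition D_inf :: "nat \<Rightarrow> (nat \<Rightarrow> curve) \<Rightarrow> curve \<Rightarrow> real" where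
  "D_inf = infimal_depth global_band"

definition D_FW :: "nat \<Rightarrow> (nat \<Rightarrow> curve) \<Rightarrow> curve \<Rightarrow> real" where
  "D_FW = integral_depth fw_band"

definition D_FW_inf :: "nat \<Rightarrow> (nat \<Rightarrow> curve) \<Rightarrow> curve \<Rightarrow> real" where
  "D_FW_inf = infimal_depth fw_band"

end

theory Submission
  imports Defs
begin

text \<open>Each depth averages, over the \<open>n choose 2\<close> pairs, numbers in [0,1]: values
  of \<mu>_C, whose mass is at most 1 (\<open>measure_arc_measure_le_1\<close>), or indicators.
  \<open>pair_average_in_unit_interval\<close> bounds such averages; the band stays arbitrary, so
  one argument serves both bands.\<close>

text \<open>Holds without measurability of \<open>f\<close>: the junk values of \<^const>\<open>distr\<close> and
  \<^const>\<open>emeasure\<close> are \<open>0\<close>.\<close>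

lemma emeasure_distr_le_space: "emeasure (distr M N f) A \<le> emeasure M (space M)"
  unfolding distr_def by (simp add: emeasure_measure_of_conv emeasure_space)

text \<open>Lebesgue measure on an interval of length L has mass L, pushing forward does not
  increase it, and the scaling divides by L.\<close>

lemma measure_arc_measure_le_1:
  assumes "curve_length C > 0"
  shows "measure (arc_measure C) A \<le> 1"
proof -
  let ?L = "curve_length C"
  have "emeasure (distr (restrict_space lborel {0..?L}) borel (arc_rep C)) A \<le> ennreal ?L"
    using emeasure_distr_le_space[of "restrict_space lborel {0..?L}" borel "arc_rep C" A] assms
    by (simp add: space_restrict_space emeasure_restrict_space)
  then have "emeasure (arc_measure C) A \<le> ennreal (1 / ?L) * ennreal ?L"
    unfolding arc_measure_def emeasure_scale_measure by (rule mult_left_mono) simp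
  also have "\<dots> = 1"
    using assms by (simp flip: ennreal_mult)
  finally show ?thesis
    by (simp add: measure_def enn2real_leI)
qed

lemma card_ordered_pairs: "card {(i, j). 1 \<le> i \<and> i < j \<and> j \<le> n} = n choose 2"
proof -
  \<comment> \<open>Grouping by the larger index \<open>j\<close> leaves \<open>j - 1\<close>
    choices of \<open>i\<close>; for \<open>j = 0\<close> truncated subtraction correctly gives
    0.\<close>
  have "{(i, j). 1 \<le> i \<and> i < j \<and> j \<le> n} = prod.swap ` (SIGMA j:{..n}. {1..<j})"
    by (auto simp: image_iff)
  then have "card {(i, j). 1 \<le> i \<and> i < j \<and> j \<le> n} = (\<Sum>j\<le>n. j - 1)"
    by (simp add: card_image)
  also have "\<dots> = n choose 2"
    \<comment> \<open>Writing 2 as \<open>Suc (Suc 0)\<close> lets Pascal's rule simplify.\<close>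
    by (induction n) (auto simp: numeral_2_eq_2)
  finally show ?thesis .
qed

lemma pair_average_in_unit_interval:
  fixes f :: "nat \<Rightarrow> nat \<Rightarrow> real"
  assumes "\<And>i j. f i j \<in> {0..1}"
  shows "inverse (real (n choose 2)) * (\<Sum>(i, j) | 1 \<le> i \<and> i < j \<and> j \<le> n. f i j) \<in> {0..1}"
    (is "_ * ?S \<in> _")
proof -
  \<comment> \<open>The factor \<open>* 1\<close>, with the binomial read as a cardinality, fits
    \<open>sum_bounded_above\<close>.\<close>
  have "?S \<le> real (n choose 2) * 1"
    unfolding card_ordered_pairs[symmetric] using assms
    by (intro sum_bounded_above) auto
  moreover have "?S \<ge> 0"
    using assms by (intro sum_nonneg) auto
  ultimately show ?thesis
    \<comment> \<open>When there are no pairs, \<open>inverse 0 = 0\<close> makes the average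
      0.\<close>
    by (auto simp: divide_inverse_commute[symmetric] divide_le_eq_1)
qed

lemma integral_depth_in_unit_interval:
  assumes "curve_length C > 0"
  shows "integral_depth band n Cs C \<in> {0..1}"
  unfolding integral_depth_def
  using measure_arc_measure_le_1[OF assms] by (intro pair_average_in_unit_interval) simp

lemma infimal_depth_in_unit_interval: "infimal_depth band n Cs C \<in> {0..1}"
  unfolding infimal_depth_def by (intro pair_average_in_unit_interval) simp

theorem proposition4p1:
  fixes n :: nat and Cs :: "nat \<Rightarrow> curve" and C :: curve
  assumes "n \<ge> 2"
    and "\<And>i. i \<in> {1..n} \<Longrightarrow> Cs i \<in> curves"
    and "\<And>i. i \<in> {1..n} \<Longrightarrow> curve_length (Cs i) > 0"
    and "\<And>i. i \<in> {1..n} \<Longrightarrow> non_atomic (arc_measure (Cs i))"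
    and "C \<in> curves"
    and "curve_length C > 0"
    and "non_atomic (arc_measure C)"
  shows "D_int n Cs C \<in> {0..1} \<and> D_inf n Cs C \<in> {0..1} \<and>
         D_FW n Cs C \<in> {0..1} \<and> D_FW_inf n Cs C \<in> {0..1}"
  unfolding D_int_def D_inf_def D_FW_def D_FW_inf_def
  using integral_depth_in_unit_interval[OF assms(6)] infimal_depth_in_unit_interval by blast

end
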